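(* Let $t \geq 4$ be an integer. Every $n$-vertex $K_t$-minor-free graph $G$ is (a) isomorphic to a subgraph of $H \boxtimes K_{\lfloor m \rfloor}$ for some graph $H$ with $\mathrm{tw}(H) \leq t - 1$, where $m := \sqrt{(t - 3)n}$; and (b) isomorphic to a subgraph of $H \boxtimes K_{\lfloor m \rfloor}$ for some graph $H$ with $\mathrm{tw}(H) \leq t - 2$, where $m := 2\sqrt{(t - 3)n}$.
   Context: All graphs are finite, simple and undirected. $\mathrm{tw}$ denotes treewidth. The strong product $A \boxtimes B$ of graphs $A$ and $B$ has vertex-set $V(A) \times V(B)$, where distinct vertices $(v,x),(w,y)$ are adjacent if ($v=w$ and $xy \in E(B)$), or ($x=y$ and $vw \in E(A)$), or ($vw \in E(A)$ and $xy \in E(B)$). $K_m$ is the complete graph on $m$ vertices. *)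

theory Defs
  imports Complex_Main "Graph_Theory.Graph_Theory"
begin

text \<open>
  A finite simple undirected graph is a \<open>pair_graph\<close>: a finite vertex set together with a
  symmetric irreflexive arc relation, each undirected edge being the two opposite arcs.
\<close>

definition complete_graph :: "nat \<Rightarrow> nat pair_pre_digraph" where
  "complete_graph m = \<lparr>pverts = {..<m}, parcs = {(x, y). x < m \<and> y < m \<and> x \<noteq> y}\<rparr>"

definition strong_product ::
  "'a pair_pre_digraph \<Rightarrow> 'b pair_pre_digraph \<Rightarrow> ('a \<times> 'b) pair_pre_digraph" (infixl \<open>\<boxtimes>\<close> 70)
where
  "A \<boxtimes> B = \<lparr>pverts = pverts A \<times> pverts B,
     parcs = {((v, x), (w, y)).
       (v, x) \<in> pverts A \<times> pverts B \<and> (w, y) \<in> pverts A \<times> pverts B \<and> (v, x) \<noteq> (w, y) \<and>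
       ((v = w \<and> (x, y) \<in> parcs B) \<or>
        (x = y \<and> (v, w) \<in> parcs A) \<or>
        ((v, w) \<in> parcs A \<and> (x, y) \<in> parcs B))}\<rparr>"

definition isomorphic_to_subgraph :: "'a pair_pre_digraph \<Rightarrow> 'b pair_pre_digraph \<Rightarrow> bool" where
  "isomorphic_to_subgraph G P \<longleftrightarrow>
     (\<exists>S. subgraph S (with_proj P) \<and> digraph_iso (with_proj G) S)"

text \<open>
  Minors are given by branch sets. The library's \<open>connected\<close> entails that the graph is
  nonempty, so branch sets are nonempty.
\<close>

definition minor_model ::
  "'b pair_pre_digraph \<Rightarrow> 'a pair_pre_digraph \<Rightarrow> ('b \<Rightarrow> 'a set) \<Rightarrow> bool" where
  "minor_model H G \<mu> \<longleftrightarrow>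
     (\<forall>x \<in> pverts H. \<mu> x \<subseteq> pverts G \<and> Digraph_Component.connected (with_proj G \<restriction> \<mu> x)) \<and>
     (\<forall>x \<in> pverts H. \<forall>y \<in> pverts H. x \<noteq> y \<longrightarrow> \<mu> x \<inter> \<mu> y = {}) \<and>
     (\<forall>(x, y) \<in> parcs H. \<exists>u \<in> \<mu> x. \<exists>v \<in> \<mu> y. (u, v) \<in> parcs G)"

definition is_minor :: "'b pair_pre_digraph \<Rightarrow> 'a pair_pre_digraph \<Rightarrow> bool" where
  "is_minor H G \<longleftrightarrow> (\<exists>\<mu>. minor_model H G \<mu>)"

abbreviation minor_free :: "'b pair_pre_digraph \<Rightarrow> 'a pair_pre_digraph \<Rightarrow> bool" where
  "minor_free H G \<equiv> \<not> is_minor H G"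

text \<open>
  The library's \<open>forest\<close> forbids every directed cycle and hence, for a symmetric arc relation,
  every edge. Cycles of an undirected graph are the directed cycles of length at least 3.
\<close>

definition undirected_tree :: "'a pair_pre_digraph \<Rightarrow> bool" where
  "undirected_tree T \<longleftrightarrow>
     pair_graph T \<and> Digraph_Component.connected (with_proj T) \<and>
     \<not> (\<exists>p. pre_digraph.cycle (with_proj T) p \<and> 3 \<le> length p)"

text \<open>
  Since trees are finite, taking their nodes to be natural numbers loses no generality.
  The last condition says that each vertex occurs in the bags of a nonempty subtree.
\<close>

definition tree_decomposition ::
  "'a pair_pre_digraph \<Rightarrow> nat pair_pre_digraph \<Rightarrow> (nat \<Rightarrow> 'a set) \<Rightarrow> bool" where
  "tree_decomposition G T B \<longleftrightarrow>
     undirected_tree T \<and>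
     (\<forall>x \<in> pverts T. B x \<subseteq> pverts G) \<and>
     (\<forall>(u, v) \<in> parcs G. \<exists>x \<in> pverts T. u \<in> B x \<and> v \<in> B x) \<and>
     (\<forall>v \<in> pverts G. Digraph_Component.connected (with_proj T \<restriction> {x \<in> pverts T. v \<in> B x}))"

definition decomposition_width :: "nat pair_pre_digraph \<Rightarrow> (nat \<Rightarrow> 'a set) \<Rightarrow> int" where
  "decomposition_width T B = Max ((\<lambda>x. int (card (B x))) ` pverts T) - 1"

text \<open>
  For a finite graph the infimum is a minimum: the trivial decomposition shows that the set is
  nonempty, and widths are at least -1 (attained for the graph without vertices).
\<close>

definition treewidth :: "'a pair_pre_digraph \<Rightarrow> int" where
  "treewidth G = Inf {decomposition_width T B | T B. tree_decomposition G T B}"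

lemma complete_digraph_complete_graph: "complete_digraph m (with_proj (complete_graph m))"
  unfolding complete_digraph_pair_def by (auto simp: complete_graph_def)

lemma pair_graph_strong_product:
  assumes "pair_graph A" "pair_graph B"
  shows "pair_graph (A \<boxtimes> B)"
proof -
  interpret A: pair_graph A by fact
  interpret B: pair_graph B by fact
  have sA: "(w, v) \<in> parcs A" if "(v, w) \<in> parcs A" for v w
    using that A.pair_sym_arcs by (auto simp: symmetric_def dest: symD)
  have sB: "(w, v) \<in> parcs B" if "(v, w) \<in> parcs B" for v w
    using that B.pair_sym_arcs by (auto simp: symmetric_def dest: symD)
  have fin: "finite (pverts (A \<boxtimes> B))"
    using A.pair_finite_verts B.pair_finite_verts by (simp add: strong_product_def)
  have sub: "parcs (A \<boxtimes> B) \<subseteq> pverts (A \<boxtimes> B) \<times> pverts (A \<boxtimes> B)"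
    by (auto simp: strong_product_def)
  have "finite (parcs (A \<boxtimes> B))"
    using finite_subset[OF sub] fin by simp
  moreover have "symmetric (with_proj (A \<boxtimes> B))"
    unfolding symmetric_def by (auto simp: strong_product_def intro!: symI dest: sA sB)
  moreover have "fst e \<noteq> snd e" if "e \<in> parcs (A \<boxtimes> B)" for e
    using that by (auto simp: strong_product_def)
  ultimately show ?thesis
    using fin sub by unfold_locales auto
qed

end

theory Submission
  imports Defs
begin

text \<open>
  One graph \<open>H\<close> of treewidth at most \<open>t - 2\<close> and parts of order at most
  \<open>q = \<lfloor>sqrt ((t - 3) n)\<rfloor>\<close> serve for both claims. The parts are chosen one at a time. For each
  component \<open>C\<close> of the graph induced by the vertices not yet chosen we keep disjoint, connected,
  pairwise adjacent sets \<open>U i\<close>, all adjacent to \<open>C\<close> and disjoint from it, such that every neighbour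
  of \<open>C\<close> lies in \<open>U i \<inter> P i\<close> for some part \<open>P i\<close>. Together with \<open>C\<close> they form a model of a complete
  graph, so there are at most \<open>t - 2\<close> of them. By the lemma of Alon, Seymour and Thomas, \<open>C\<close> contains
  either a connected set of order at most \<open>q\<close> adjacent to all \<open>U i\<close>, or a set \<open>Z\<close> of order at most
  \<open>q\<close> such that no component of \<open>C - Z\<close> is adjacent to all of them. In the first case this set is
  the next part, and a branch set of its own. In the second case a minimal \<open>Z\<close> is the next part: if
  a component \<open>D\<close> of \<open>C - Z\<close> is not adjacent to \<open>U j\<close>, then by minimality the neighbours of \<open>D\<close> in
  \<open>Z\<close> are connected to \<open>U j\<close> within \<open>C - D\<close>, so that \<open>U j\<close> can be enlarged to contain them. In
  either case the new part and the parts seen from \<open>C\<close> form a bag with at most \<open>t - 1\<close> elements.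
\<close>

section \<open>Connected sets and separators\<close>

definition adj_sets :: "('a \<times> 'a) set \<Rightarrow> 'a set \<Rightarrow> 'a set \<Rightarrow> bool" where
  "adj_sets E X Y \<longleftrightarrow> (\<exists>x\<in>X. \<exists>y\<in>Y. (x, y) \<in> E)"

text \<open>Connectivity is phrased through cuts instead of walks, so that reachability arguments
  become arguments about sets closed under adjacency.\<close>

definition cut_connected :: "('a \<times> 'a) set \<Rightarrow> 'a set \<Rightarrow> bool" where
  "cut_connected E S \<longleftrightarrow> S \<noteq> {} \<and> (\<forall>A. A \<noteq> {} \<longrightarrow> A \<subset> S \<longrightarrow> adj_sets E A (S - A))"

definition is_component :: "('a \<times> 'a) set \<Rightarrow> 'a set \<Rightarrow> 'a set \<Rightarrow> bool" where
  "is_component E R D \<longleftrightarrow> cut_connected E D \<and> D \<subseteq> R \<and> \<not> adj_sets E D (R - D)"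

lemma adj_sets_mono: "adj_sets E X Y \<Longrightarrow> X \<subseteq> X' \<Longrightarrow> Y \<subseteq> Y' \<Longrightarrow> adj_sets E X' Y'"
  unfolding adj_sets_def by blast

lemma adj_sets_commute: "sym E \<Longrightarrow> adj_sets E X Y \<longleftrightarrow> adj_sets E Y X"
  unfolding adj_sets_def by (blast dest: symD)

lemma cut_connected_singleton: "cut_connected E {x}"
  by (auto simp: cut_connected_def psubset_eq subset_singleton_iff)

text \<open>Replaces induction along a path: if \<open>Q\<close> failed somewhere on
  \<open>S\<close>, the elements satisfying it would form a cut that no edge crosses.\<close>

lemma cut_connected_closed_subset:
  assumes "cut_connected E S" "x \<in> S" "Q x"
    and "\<And>u v. u \<in> S \<Longrightarrow> v \<in> S \<Longrightarrow> Q u \<Longrightarrow> (u, v) \<in> E \<Longrightarrow> Q v"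
    and "y \<in> S"
  shows "Q y"
proof (rule ccontr)
  assume "\<not> Q y"
  then have "{u \<in> S. Q u} \<subset> S" "{u \<in> S. Q u} \<noteq> {}" using assms by auto
  then have "adj_sets E {u \<in> S. Q u} (S - {u \<in> S. Q u})"
    using assms(1) by (simp add: cut_connected_def)
  then show False using assms(4) by (auto simp: adj_sets_def)
qed

text \<open>Closed sets through one base point suffice: for symmetric \<open>E\<close> the
  complement of a closed set is closed too, and \<open>x\<close> lies in one of the two.\<close>

lemma cut_connectedI:
  assumes "x \<in> S"
    and "\<And>A y. x \<in> A \<Longrightarrow> A \<subseteq> S \<Longrightarrow> (\<And>u v. u \<in> A \<Longrightarrow> v \<in> S \<Longrightarrow> (u, v) \<in> E \<Longrightarrow> v \<in> A) \<Longrightarrow> y \<in> S \<Longrightarrow> y \<in> A"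
    and "sym E"
  shows "cut_connected E S"
  unfolding cut_connected_def
proof (intro conjI allI impI)
  show "S \<noteq> {}" using assms by blast
  fix A assume A: "A \<noteq> {}" "A \<subset> S"
  show "adj_sets E A (S - A)"
  proof (rule ccontr)
    assume n: "\<not> adj_sets E A (S - A)"
    show False
    proof (cases "x \<in> A")
      case True
      have "y \<in> A" if "y \<in> S" for y
        by (rule assms(2)[OF True _ _ that]) (use A n in \<open>auto simp: adj_sets_def\<close>)
      then show False using A by blast
    next
      case False
      have "y \<in> S - A" if "y \<in> S" for y
      proof (rule assms(2)[OF _ _ _ that])
        show "x \<in> S - A" using False assms(1) by blast
        show "v \<in> S - A" if "u \<in> S - A" "v \<in> S" "(u, v) \<in> E" for u v
          using that n symD[OF assms(3)] unfolding adj_sets_def by blast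
      qed auto
      then show False using A by blast
    qed
  qed
qed

lemma cut_connected_Un:
  assumes "sym E" "cut_connected E S" "cut_connected E T" "S \<inter> T \<noteq> {} \<or> adj_sets E S T"
  shows "cut_connected E (S \<union> T)"
proof -
  obtain x where x: "x \<in> S" using assms(2) unfolding cut_connected_def by blast
  show ?thesis
  proof (rule cut_connectedI[of x])
    fix A y
    assume A: "x \<in> A" "A \<subseteq> S \<union> T" "\<And>u v. u \<in> A \<Longrightarrow> v \<in> S \<union> T \<Longrightarrow> (u, v) \<in> E \<Longrightarrow> v \<in> A"
      and y: "y \<in> S \<union> T"
    have S: "z \<in> A" if "z \<in> S" for z
      using cut_connected_closed_subset[OF assms(2) x, of "\<lambda>z. z \<in> A"] A that by blast
    obtain z where z: "z \<in> T" "z \<in> A"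
      using assms(4) S A(3) unfolding adj_sets_def by blast
    have "w \<in> A" if "w \<in> T" for w
      using cut_connected_closed_subset[OF assms(3) z(1), of "\<lambda>z. z \<in> A"] z A that by blast
    with S y show "y \<in> A" by blast
  qed (use x assms in auto)
qed

text \<open>The intersection of all closed subsets of \<open>R\<close> through \<open>x\<close> is
  closed; a closed subset of it through \<open>x\<close> belongs to the same family, hence is all of
  it.\<close>

lemma component_containing:
  assumes "sym E" "x \<in> R"
  obtains D where "is_component E R D" "x \<in> D"
proof
  define F where "F = {A. A \<subseteq> R \<and> x \<in> A \<and> \<not> adj_sets E A (R - A)}"
  have R: "R \<in> F" using assms unfolding F_def adj_sets_def by blast
  have cl: "v \<in> \<Inter>F" if "u \<in> \<Inter>F" "v \<in> R" "(u, v) \<in> E" for u v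
    using that unfolding F_def adj_sets_def by blast
  have "cut_connected E (\<Inter>F)"
  proof (rule cut_connectedI[of x])
    fix A y
    assume A: "x \<in> A" "A \<subseteq> \<Inter>F" "\<And>u v. u \<in> A \<Longrightarrow> v \<in> \<Inter>F \<Longrightarrow> (u, v) \<in> E \<Longrightarrow> v \<in> A"
      and y: "y \<in> \<Inter>F"
    have "\<not> adj_sets E A (R - A)"
      unfolding adj_sets_def
    proof clarify
      fix a b assume ab: "a \<in> A" "b \<in> R" "b \<notin> A" "(a, b) \<in> E"
      then have "b \<in> \<Inter>F" using cl A(2) by blast
      with ab A(3) show False by blast
    qed
    then have "A \<in> F" using A R unfolding F_def by blast
    with y show "y \<in> A" by blast
  qed (use assms F_def in auto)
  then show "is_component E R (\<Inter>F)"
    using R cl unfolding is_component_def adj_sets_def by blast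
  show "x \<in> \<Inter>F" unfolding F_def by blast
qed

lemma component_absorbs_connected:
  assumes "is_component E R D" "cut_connected E K" "K \<subseteq> R" "K \<inter> D \<noteq> {}"
  shows "K \<subseteq> D"
proof
  fix y assume "y \<in> K"
  obtain x where x: "x \<in> K" "x \<in> D" using assms(4) by blast
  show "y \<in> D"
    by (rule cut_connected_closed_subset[OF assms(2) x(1), where Q = "\<lambda>z. z \<in> D", OF x(2) _ \<open>y \<in> K\<close>])
       (use assms(1,3) in \<open>auto simp: is_component_def adj_sets_def\<close>)
qed

text \<open>
  Lemma of Alon, Seymour and Thomas. Put \<open>d u i\<close> for the least order of a connected set that
  contains \<open>u\<close> and meets \<open>A 0, \<dots>, A i\<close>. Along an edge \<open>d\<close> grows by at most one, and passing from
  \<open>i\<close> to \<open>i + 1\<close> at a vertex of \<open>A (i + 1)\<close> does not increase it. Hence each level set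
  \<open>{(u, i). d u i = s}\<close> with \<open>s \<le> q + 1\<close> projects to a separator, and one of these is small.
\<close>

lemma small_connected_set_or_separator:
  fixes A :: "nat \<Rightarrow> 'a set"
  assumes E: "sym E" and fin: "finite C" and q: "1 \<le> q"
    and small: "k * card C < Suc q * Suc q"
  shows "(\<exists>S\<subseteq>C. cut_connected E S \<and> card S \<le> q \<and> (\<forall>i\<le>k. S \<inter> A i \<noteq> {})) \<or>
         (\<exists>Z\<subseteq>C. card Z \<le> q \<and> (\<forall>K\<subseteq>C - Z. cut_connected E K \<longrightarrow> (\<exists>i\<le>k. K \<inter> A i = {})))"
proof (cases k)
  case 0
  show ?thesis
  proof (cases "C \<inter> A 0 = {}")
    case True
    then show ?thesis using 0 by (intro disjI2 exI[of _ "{}"]) auto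
  next
    case False
    then obtain a where "a \<in> C" "a \<in> A 0" by blast
    then show ?thesis using 0 q
      by (intro disjI1 exI[of _ "{a}"]) (auto simp: cut_connected_singleton)
  qed
next
  case (Suc k')
  \<comment> \<open>\<open>P s u i\<close> encodes \<open>d u i \<le> s\<close> and is false where
    no such set exists. Hence \<open>W s\<close> is the level set of value
    \<open>s + 1\<close>.\<close>
  define P where "P s u i \<longleftrightarrow>
    (\<exists>S\<subseteq>C. cut_connected E S \<and> u \<in> S \<and> card S \<le> s \<and> (\<forall>j\<le>i. S \<inter> A j \<noteq> {}))" for s u i
  define W where "W s = {(u, i). u \<in> C \<and> i < k \<and> P (Suc s) u i \<and> \<not> P s u i}" for s
  have P_mono: "P s' u i" if "P s u i" "s \<le> s'" for s s' u i
    using that unfolding P_def by (meson order_trans)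
  have W_sub: "W s \<subseteq> C \<times> {..<k}" for s unfolding W_def by auto
  then have W_fin: "finite (W s)" for s using fin finite_subset by (metis finite_SigmaI finite_lessThan)
  have W_disj: "W s \<inter> W s' = {}" if "s < s'" for s s'
    unfolding W_def using P_mono[of "Suc s" _ _ s'] that by auto
  \<comment> \<open>Otherwise the \<open>q + 1\<close> disjoint level sets would have at least
    \<open>(q + 1)^2\<close> elements in \<open>C \<times> {..<k}\<close>.\<close>
  have "\<exists>s\<le>q. card (W s) \<le> q"
  proof (rule ccontr)
    assume "\<not> ?thesis"
    then have big: "Suc q \<le> card (W s)" if "s \<le> q" for s using that by (meson not_less_eq_eq)
    have "Suc q * Suc q = (\<Sum>s\<le>q. Suc q)" by simp
    also have "\<dots> \<le> (\<Sum>s\<le>q. card (W s))" using big by (intro sum_mono) auto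
    also have "\<dots> = card (\<Union>s\<le>q. W s)"
    proof (rule card_UN_disjoint[symmetric])
      show "\<forall>i\<in>{..q}. \<forall>j\<in>{..q}. i \<noteq> j \<longrightarrow> W i \<inter> W j = {}"
        using W_disj by (metis Int_commute linorder_neqE_nat)
    qed (use W_fin in auto)
    also have "\<dots> \<le> card (C \<times> {..<k})"
      using W_sub fin by (intro card_mono) auto
    also have "\<dots> = k * card C" by (simp add: card_cartesian_product)
    finally show False using small by (meson not_le)
  qed
  then obtain s where s: "s \<le> q" "card (W s) \<le> q" by blast
  define Z where "Z = fst ` W s"
  have Z: "Z \<subseteq> C" "card Z \<le> q"
    using W_sub card_image_le[OF W_fin, of fst s] s unfolding Z_def by fastforce+
  show ?thesis
  proof (cases "\<forall>K\<subseteq>C - Z. cut_connected E K \<longrightarrow> (\<exists>i\<le>k. K \<inter> A i = {})")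
    case True
    then show ?thesis using Z by (intro disjI2 exI[of _ Z] conjI)
  next
    case False
    then obtain K where K: "K \<subseteq> C - Z" "cut_connected E K" "\<forall>i\<le>k. K \<inter> A i \<noteq> {}"
      by blast
    \<comment> \<open>\<open>K\<close> avoids the projection of \<open>W s\<close>, so on
      \<open>K\<close> the value \<open>s + 1\<close> is never attained.\<close>
    have drop: "P s u i" if "P (Suc s) u i" "u \<in> K" "i < k" for u i
    proof (rule ccontr)
      assume "\<not> P s u i"
      then have "(u, i) \<in> W s" using that K(1) unfolding W_def by auto
      then have "u \<in> Z" unfolding Z_def by force
      then show False using that K(1) by blast
    qed
    have step: "P (Suc s) v i" if uv: "P s u i" "(u, v) \<in> E" "v \<in> K" for u v i
    proof -
      obtain S where S: "S \<subseteq> C" "cut_connected E S" "u \<in> S" "card S \<le> s" "\<forall>j\<le>i. S \<inter> A j \<noteq> {}"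
        using uv(1) unfolding P_def by blast
      have "cut_connected E (S \<union> {v})"
        using cut_connected_Un[OF E S(2) cut_connected_singleton] S(3) uv(2)
        unfolding adj_sets_def by blast
      moreover have "card (S \<union> {v}) \<le> Suc s"
        using S(4) card_insert_le_m1[of "Suc s" S v] by simp
      ultimately show ?thesis unfolding P_def
        using S(1,5) uv(3) K(1) by (intro exI[of _ "S \<union> {v}"]) auto
    qed
    \<comment> \<open>Crossing an edge of \<open>K\<close> raises the bound to \<open>s + 1\<close>
      by \<open>step\<close>, and \<open>drop\<close> takes it back to \<open>s\<close>.\<close>
    have spread: "P s v i" if "u \<in> K" "P s u i" "v \<in> K" "i < k" for u v i
      by (rule cut_connected_closed_subset[OF K(2) that(1), where Q = "\<lambda>w. P s w i", OF that(2) _ that(3)])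
         (use drop step that(4) in blast)
    have all: "P s u i" if "i < k" "u \<in> K" for u i
      using that
    proof (induction i arbitrary: u)
      case 0
      obtain a where a: "a \<in> K" "a \<in> A 0" using K(3) by blast
      then have "P (Suc s) a 0" unfolding P_def using K(1)
        by (intro exI[of _ "{a}"]) (auto simp: cut_connected_singleton)
      then show ?case using spread drop a 0 by blast
    next
      case (Suc i)
      obtain a where a: "a \<in> K" "a \<in> A (Suc i)" using K(3) Suc.prems(1) less_imp_le by blast
      then have "P s a i" using Suc by simp
      then have "P s a (Suc i)" using a unfolding P_def by (metis disjoint_iff le_Suc_eq)
      then show ?case using spread a Suc.prems by blast
    qed
    obtain a where a: "a \<in> K" "a \<in> A k" using K(3) by blast
    \<comment> \<open>The last index has no level set: at a vertex of \<open>A k\<close> the set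
      found for \<open>k'\<close> already meets \<open>A k\<close>.\<close>
    have "P s a k'" using all a Suc by simp
    then have "P s a k" using a Suc unfolding P_def by (metis disjoint_iff le_Suc_eq)
    then obtain S where "S \<subseteq> C" "cut_connected E S" "card S \<le> s" "\<forall>j\<le>k. S \<inter> A j \<noteq> {}"
      unfolding P_def by blast
    then show ?thesis using s(1) by (intro disjI1 exI[of _ S]) simp
  qed
qed

section \<open>Boundary models\<close>

text \<open>
  \<open>P\<close> lists the parts constructed so far and \<open>C\<close> is a component of what is left. The sets \<open>U i\<close>
  form, together with \<open>C\<close>, a model of a complete graph; only their traces \<open>P i \<inter> U i\<close> are seen
  from \<open>C\<close>, but they may use vertices that are not in any part yet.
\<close>

definition boundary_model ::
  "('a \<times> 'a) set \<Rightarrow> 'a set \<Rightarrow> (nat \<Rightarrow> 'a set) \<Rightarrow> 'a set \<Rightarrow> nat set \<Rightarrow> (nat \<Rightarrow> 'a set) \<Rightarrow> bool" where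
  "boundary_model E V P C I U \<longleftrightarrow>
     (\<forall>i\<in>I. U i \<subseteq> V \<and> cut_connected E (U i) \<and> U i \<inter> C = {} \<and> adj_sets E (U i) C) \<and>
     (\<forall>i\<in>I. \<forall>j\<in>I. i \<noteq> j \<longrightarrow> U i \<inter> U j = {} \<and> adj_sets E (U i) (U j)) \<and>
     (\<forall>v c. (v, c) \<in> E \<longrightarrow> c \<in> C \<longrightarrow> v \<notin> C \<longrightarrow> (\<exists>i\<in>I. v \<in> P i \<inter> U i))"

lemma boundary_modelD:
  assumes "boundary_model E V P C I U"
  shows "i \<in> I \<Longrightarrow> U i \<subseteq> V" "i \<in> I \<Longrightarrow> cut_connected E (U i)" "i \<in> I \<Longrightarrow> U i \<inter> C = {}"
    "i \<in> I \<Longrightarrow> adj_sets E (U i) C"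
    "i \<in> I \<Longrightarrow> j \<in> I \<Longrightarrow> i \<noteq> j \<Longrightarrow> U i \<inter> U j = {}"
    "i \<in> I \<Longrightarrow> j \<in> I \<Longrightarrow> i \<noteq> j \<Longrightarrow> adj_sets E (U i) (U j)"
    "(v, c) \<in> E \<Longrightarrow> c \<in> C \<Longrightarrow> v \<notin> C \<Longrightarrow> \<exists>i\<in>I. v \<in> P i \<inter> U i"
  using assms by (simp_all add: boundary_model_def)

text \<open>\<open>S\<close> is both the new part and a new branch set. Branch sets not adjacent to
  \<open>D\<close> are discarded. A neighbour of \<open>D\<close> outside \<open>D\<close> lies in
  \<open>S\<close> or outside \<open>C\<close>, where the old model covers it.\<close>

lemma boundary_model_add_connected_part:
  assumes E: "sym E" and CV: "C \<subseteq> V" and M: "boundary_model E V P C I U" and h: "h \<notin> I"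
    and S: "S \<subseteq> C" "cut_connected E S" "\<And>i. i \<in> I \<Longrightarrow> adj_sets E (U i) S"
    and D: "is_component E (C - S) D"
  shows "\<exists>I' U'. I' \<subseteq> insert h I \<and> boundary_model E V (P(h := S)) D I' U'"
proof -
  note M = boundary_modelD[OF M]
  have D': "cut_connected E D" "D \<subseteq> C - S" "\<not> adj_sets E D (C - S - D)"
    using D unfolding is_component_def by auto
  define U' where "U' = U(h := S)"
  define I' where "I' = {i \<in> insert h I. adj_sets E (U' i) D}"
  have U': "U' i = U i" if "i \<in> I" for i using that h unfolding U'_def by auto
  have h': "U' h = S" unfolding U'_def by simp
  have "boundary_model E V (P(h := S)) D I' U'"
    unfolding boundary_model_def
  proof (intro conjI ballI allI impI)
    fix i assume i: "i \<in> I'"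
    show "adj_sets E (U' i) D" using i unfolding I'_def by simp
    consider "i = h" | "i \<in> I" using i unfolding I'_def by blast
    then have "U' i \<subseteq> V \<and> cut_connected E (U' i) \<and> U' i \<inter> D = {}"
      by cases (use M(1-3)[of i] S(1,2) CV D'(2) U'[of i] h' in auto)
    then show "U' i \<subseteq> V" "cut_connected E (U' i)" "U' i \<inter> D = {}" by auto
  next
    fix i j assume ij: "i \<in> I'" "j \<in> I'" "i \<noteq> j"
    have hj: "S \<inter> U j = {}" "adj_sets E S (U j)" "adj_sets E (U j) S" if "j \<in> I" for j
      using that S M(3)[of j] E by (auto simp: adj_sets_commute)
    consider "i \<in> I" "j \<in> I" | "i = h" "j \<in> I" | "i \<in> I" "j = h"
      using ij unfolding I'_def by blast
    then have "U' i \<inter> U' j = {} \<and> adj_sets E (U' i) (U' j)"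
      by cases (use M(5,6)[of i j] hj[of i] hj[of j] U' h' ij(3) in auto)
    then show "U' i \<inter> U' j = {}" "adj_sets E (U' i) (U' j)" by auto
  next
    fix v c assume vc: "(v, c) \<in> E" "c \<in> D" "v \<notin> D"
    show "\<exists>i\<in>I'. v \<in> (P(h := S)) i \<inter> U' i"
    proof (cases "v \<in> C")
      case True
      then have "v \<in> S" using vc D'(3) symD[OF E vc(1)] unfolding adj_sets_def by blast
      moreover from this have "h \<in> I'" using vc h' unfolding I'_def adj_sets_def by auto
      ultimately show ?thesis using h' by (intro bexI[of _ h]) auto
    next
      case False
      then obtain i where i: "i \<in> I" "v \<in> P i \<inter> U i" using M(7)[OF vc(1)] vc D' by blast
      then have "i \<in> I'" using vc U' unfolding I'_def adj_sets_def by auto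
      then show ?thesis using i U' h by (intro bexI[of _ i]) auto
    qed
  qed
  moreover have "I' \<subseteq> insert h I" unfolding I'_def by auto
  ultimately show ?thesis by (intro exI conjI)
qed

text \<open>
  Minimality of \<open>Z\<close> ties every vertex of \<open>Z\<close> next to \<open>D\<close> to \<open>U j\<close> outside \<open>D\<close>, so \<open>U j\<close> can be
  enlarged to a branch set whose trace is the boundary of \<open>D\<close> in \<open>Z\<close>.
\<close>

lemma boundary_model_add_minimal_separator:
  assumes E: "sym E" and CV: "C \<subseteq> V" and M: "boundary_model E V P C I U" and h: "h \<notin> I"
    and Z: "Z \<subseteq> C"
    and sep: "\<And>K. K \<subseteq> C - Z \<Longrightarrow> cut_connected E K \<Longrightarrow> \<exists>i\<in>I. \<not> adj_sets E (U i) K"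
    and min: "\<And>z. z \<in> Z \<Longrightarrow>
      \<exists>K\<subseteq>C - (Z - {z}). cut_connected E K \<and> (\<forall>i\<in>I. adj_sets E (U i) K)"
    and D: "is_component E (C - Z) D"
  shows "\<exists>I' U'. I' \<subseteq> insert h I \<and> boundary_model E V (P(h := Z)) D I' U'"
proof -
  note M = boundary_modelD[OF M]
  have D': "cut_connected E D" "D \<subseteq> C - Z" "\<not> adj_sets E D (C - Z - D)"
    using D unfolding is_component_def by auto
  obtain j where j: "j \<in> I" "\<not> adj_sets E (U j) D" using sep D' by blast
  obtain u0 where u0: "u0 \<in> U j" using M(2)[OF j(1)] unfolding cut_connected_def by blast
  \<comment> \<open>\<open>W\<close> is \<open>U j\<close> enlarged by everything it reaches in
    \<open>C - D\<close>; it becomes the branch set of the new part.\<close>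
  obtain W where W: "is_component E (U j \<union> (C - D)) W" "u0 \<in> W"
    using component_containing[OF E, of u0 "U j \<union> (C - D)"] u0 by blast
  have UW: "U j \<subseteq> W"
    using component_absorbs_connected[OF W(1) M(2)[OF j(1)]] u0 W(2) by blast
  have W': "cut_connected E W" "W \<subseteq> U j \<union> (C - D)"
    and W_closed: "\<And>x y. x \<in> W \<Longrightarrow> y \<in> U j \<union> (C - D) \<Longrightarrow> (x, y) \<in> E \<Longrightarrow> y \<in> W"
    using W(1) unfolding is_component_def adj_sets_def by blast+
  \<comment> \<open>By minimality some connected \<open>K\<close> meets \<open>Z\<close> only in
    \<open>z\<close> and touches \<open>U j\<close>, outside \<open>D\<close>. Followed from there
    to \<open>z\<close>, it stays in \<open>W\<close>.\<close>
  have ZW: "z \<in> W" if z: "z \<in> Z" for z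
  proof (rule ccontr)
    assume zW: "z \<notin> W"
    obtain K where K: "K \<subseteq> C - (Z - {z})" "cut_connected E K" "\<And>i. i \<in> I \<Longrightarrow> adj_sets E (U i) K"
      using min[OF z] by blast
    have zK: "z \<in> K"
    proof (rule ccontr)
      assume "z \<notin> K"
      then have "K \<subseteq> C - Z" using K(1) by blast
      then show False using sep K(2,3) by blast
    qed
    obtain u a where ua: "u \<in> U j" "a \<in> K" "(u, a) \<in> E"
      using K(3)[OF j(1)] unfolding adj_sets_def by blast
    then have "a \<notin> D" using j(2) unfolding adj_sets_def by blast
    then have aW: "a \<in> W" using W_closed[of u a] ua UW K(1) by blast
    have "z \<in> W"
    proof (rule cut_connected_closed_subset[OF K(2) ua(2), where Q = "\<lambda>x. x \<in> W", OF aW _ zK])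
      \<comment> \<open>\<open>K\<close> cannot enter \<open>D\<close> at this point: within
        \<open>C\<close>, edges into \<open>D\<close> come only from \<open>D\<close> and
        \<open>Z\<close>, and \<open>w\<close> lies in neither.\<close>
      fix w y assume wy: "w \<in> K" "y \<in> K" "w \<in> W" "(w, y) \<in> E"
      have w: "w \<in> C" "w \<notin> Z" using wy zW K(1) by blast+
      have "w \<notin> D" using wy w(1) W'(2) M(3)[OF j(1)] by blast
      then have "y \<notin> D" using w D'(3) symD[OF E wy(4)] unfolding adj_sets_def by blast
      then show "y \<in> W" using W_closed[OF wy(3) _ wy(4)] wy K(1) by blast
    qed
    with zW show False ..
  qed
  define U' where "U' = U(h := W)"
  \<comment> \<open>The index \<open>j\<close> leaves because \<open>W\<close> contains
    \<open>U j\<close>; no neighbour of \<open>D\<close> is lost, since \<open>U j\<close> contains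
    none.\<close>
  define I' where "I' = {i \<in> insert h (I - {j}). adj_sets E (U' i) D}"
  have U': "U' i = U i" if "i \<in> I" for i using that h unfolding U'_def by auto
  have h': "U' h = W" unfolding U'_def by simp
  have "boundary_model E V (P(h := Z)) D I' U'"
    unfolding boundary_model_def
  proof (intro conjI ballI allI impI)
    fix i assume i: "i \<in> I'"
    show "adj_sets E (U' i) D" using i unfolding I'_def by simp
    have W'': "W \<inter> D = {}" "W \<subseteq> V" using W'(2) M(1,3)[OF j(1)] D'(2) CV by blast+
    consider "i = h" | "i \<in> I" using i unfolding I'_def by blast
    then have "U' i \<subseteq> V \<and> cut_connected E (U' i) \<and> U' i \<inter> D = {}"
      by cases (use M(1-3)[of i] W'' W'(1) D'(2) U'[of i] h' in auto)
    then show "U' i \<subseteq> V" "cut_connected E (U' i)" "U' i \<inter> D = {}" by auto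
  next
    fix i l assume il: "i \<in> I'" "l \<in> I'" "i \<noteq> l"
    have hi: "W \<inter> U i = {}" "adj_sets E W (U i)" "adj_sets E (U i) W" if i: "i \<in> I - {j}" for i
    proof -
      show "W \<inter> U i = {}" using W'(2) M(3)[of i] M(5)[of i j] i j(1) by blast
      show "adj_sets E W (U i)"
        using adj_sets_mono[OF M(6)[of j i] UW order_refl] i j(1) by blast
      then show "adj_sets E (U i) W" using E by (simp add: adj_sets_commute)
    qed
    consider "i \<in> I - {j}" "l \<in> I - {j}" | "i = h" "l \<in> I - {j}" | "i \<in> I - {j}" "l = h"
      using il unfolding I'_def by blast
    then have "U' i \<inter> U' l = {} \<and> adj_sets E (U' i) (U' l)"
      by cases (use M(5,6)[of i l] hi[of i] hi[of l] U' h' il(3) in auto)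
    then show "U' i \<inter> U' l = {}" "adj_sets E (U' i) (U' l)" by auto
  next
    fix v c assume vc: "(v, c) \<in> E" "c \<in> D" "v \<notin> D"
    show "\<exists>i\<in>I'. v \<in> (P(h := Z)) i \<inter> U' i"
    proof (cases "v \<in> C")
      case True
      then have "v \<in> Z" using vc D'(3) symD[OF E vc(1)] unfolding adj_sets_def by blast
      moreover from this have "h \<in> I'" using vc h' ZW unfolding I'_def adj_sets_def by auto
      ultimately show ?thesis using h' ZW by (intro bexI[of _ h]) auto
    next
      case False
      then obtain i where i: "i \<in> I" "v \<in> P i \<inter> U i" using M(7)[OF vc(1)] vc D' by blast
      then have "i \<noteq> j" using j(2) vc unfolding adj_sets_def by blast
      then have "i \<in> I'" using i vc U' unfolding I'_def adj_sets_def by auto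
      then show ?thesis using i U' h by (intro bexI[of _ i]) auto
    qed
  qed
  moreover have "I' \<subseteq> insert h I" unfolding I'_def by auto
  ultimately show ?thesis by (intro exI conjI)
qed

text \<open>One round of the construction inside a single component. The factor
  \<open>card I - 1\<close> arises because the separator lemma numbers its sets from 0 to
  \<open>k\<close>.\<close>

lemma boundary_model_extend:
  assumes E: "sym E" and fin: "finite C" and CV: "C \<subseteq> V" and conn: "cut_connected E C"
    and M: "boundary_model E V P C I U" and finI: "finite I" and h: "h \<notin> I"
    and q: "1 \<le> q" and small: "(card I - 1) * card C < Suc q * Suc q"
  shows "\<exists>Q\<subseteq>C. Q \<noteq> {} \<and> card Q \<le> q \<and>
    (\<forall>D. is_component E (C - Q) D \<longrightarrow>
      (\<exists>I' U'. I' \<subseteq> insert h I \<and> boundary_model E V (P(h := Q)) D I' U'))"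
proof (cases "I = {}")
  case True
  obtain x where x: "x \<in> C" using conn unfolding cut_connected_def by blast
  show ?thesis
    using boundary_model_add_connected_part[OF E CV M h _ cut_connected_singleton, of x] x True q
    by (intro exI[of _ "{x}"]) auto
next
  case False
  define k where "k = card I - 1"
  have cardI: "card I = Suc k" using False finI unfolding k_def by (simp add: card_gt_0_iff)
  obtain e where e: "bij_betw e {..<card I} I"
    using ex_bij_betw_nat_finite[OF finI] atLeast0LessThan by auto
  have e_ball: "(\<forall>i\<le>k. R (e i)) \<longleftrightarrow> (\<forall>i\<in>I. R i)" for R
    using e unfolding cardI lessThan_Suc_atMost bij_betw_def by auto
  have e_bex: "(\<exists>i\<le>k. R (e i)) \<longleftrightarrow> (\<exists>i\<in>I. R i)" for R
    using e_ball[of "\<lambda>i. \<not> R i"] by blast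
  \<comment> \<open>Neighbourhoods in \<open>C\<close>: meeting \<open>A i\<close> means being
    adjacent to \<open>U i\<close>.\<close>
  define A where "A i = {c \<in> C. \<exists>u\<in>U i. (u, c) \<in> E}" for i
  have A: "K \<inter> A i \<noteq> {} \<longleftrightarrow> adj_sets E (U i) K" if "K \<subseteq> C" for K i
    using that unfolding A_def adj_sets_def by blast
  define sep where "sep Z \<longleftrightarrow>
    (\<forall>K\<subseteq>C - Z. cut_connected E K \<longrightarrow> (\<exists>i\<in>I. \<not> adj_sets E (U i) K))" for Z
  have sep_A: "sep Z \<longleftrightarrow> (\<forall>K\<subseteq>C - Z. cut_connected E K \<longrightarrow> (\<exists>i\<in>I. K \<inter> A i = {}))" for Z
    unfolding sep_def using A by (meson Diff_subset order_trans)
  have "k * card C < Suc q * Suc q" using small unfolding k_def .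
  from small_connected_set_or_separator[OF E fin q this, of "\<lambda>i. A (e i)"]
  consider S where "S \<subseteq> C" "cut_connected E S" "card S \<le> q" "\<forall>i\<in>I. S \<inter> A i \<noteq> {}"
    | Z where "Z \<subseteq> C" "card Z \<le> q" "sep Z"
    unfolding e_ball[of "\<lambda>i. S \<inter> A i \<noteq> {}" for S] e_bex[of "\<lambda>i. K \<inter> A i = {}" for K]
      sep_A[symmetric] by blast
  then show ?thesis
  proof cases
    case (1 S)
    have SU: "adj_sets E (U i) S" if "i \<in> I" for i using A[OF 1(1)] 1(4) that by blast
    have "S \<noteq> {}" using 1(2) unfolding cut_connected_def by blast
    then show ?thesis
      using boundary_model_add_connected_part[OF E CV M h 1(1,2) SU] 1(1,3) by blast
  next
    case (2 Z0)
    \<comment> \<open>Least order guarantees that deleting any single vertex destroys the separation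
      property.\<close>
    define Z where "Z = (ARG_MIN card Z. Z \<subseteq> C \<and> card Z \<le> q \<and> sep Z)"
    have Z: "Z \<subseteq> C \<and> card Z \<le> q \<and> sep Z"
      unfolding Z_def by (rule arg_min_natI) (use 2 in blast)
    have least: "card Z \<le> card Y" if "Y \<subseteq> C \<and> card Y \<le> q \<and> sep Y" for Y
      unfolding Z_def by (rule arg_min_nat_le) (use that in blast)
    have finZ: "finite Z" using Z fin finite_subset by blast
    have min: "\<exists>K\<subseteq>C - (Z - {z}). cut_connected E K \<and> (\<forall>i\<in>I. adj_sets E (U i) K)"
      if z: "z \<in> Z" for z
    proof -
      have "card (Z - {z}) < card Z" using card_Diff1_less[OF finZ z] .
      then have "\<not> sep (Z - {z})" using least[of "Z - {z}"] Z by fastforce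
      then show ?thesis unfolding sep_def by blast
    qed
    \<comment> \<open>\<open>C\<close> itself is connected and adjacent to every \<open>U i\<close>,
      so the part is nonempty and the construction progresses.\<close>
    have "\<not> sep {}" using conn boundary_modelD(4)[OF M] unfolding sep_def by blast
    then have "Z \<noteq> {}" using Z by blast
    moreover have "\<exists>I' U'. I' \<subseteq> insert h I \<and> boundary_model E V (P(h := Z)) D I' U'"
      if "is_component E (C - Z) D" for D
      by (rule boundary_model_add_minimal_separator[OF E CV M h _ _ min that])
         (use Z sep_def in blast)+
    ultimately show ?thesis using Z by blast
  qed
qed

section \<open>Construction of the partition\<close>

lemma boundary_model_cong:
  assumes "boundary_model E V P C I U" "\<And>i. i \<in> I \<Longrightarrow> P' i = P i"
  shows "boundary_model E V P' C I U"
  unfolding boundary_model_def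
proof (intro conjI ballI allI impI)
  fix v c assume "(v, c) \<in> E" "c \<in> C" "v \<notin> C"
  then obtain i where "i \<in> I" "v \<in> P i \<inter> U i" using boundary_modelD(7)[OF assms(1)] by blast
  then show "\<exists>i\<in>I. v \<in> P' i \<inter> U i" using assms(2) by (intro bexI[of _ i]) simp_all
qed (use boundary_modelD(1-6)[OF assms(1)] in \<open>simp_all\<close>)

text \<open>
  The node \<open>x\<close> of the decomposition is the one at which the part \<open>P x\<close> is created, and \<open>par x\<close> is
  its parent. The value \<open>par 0\<close> is irrelevant.
\<close>

definition rooted_partition ::
  "('a \<times> 'a) set \<Rightarrow> 'a set \<Rightarrow> nat \<Rightarrow> nat \<Rightarrow> nat \<Rightarrow> (nat \<Rightarrow> 'a set) \<Rightarrow> (nat \<Rightarrow> nat) \<Rightarrow> (nat \<Rightarrow> nat set) \<Rightarrow> bool"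
where
  "rooted_partition E V q w N P par B \<longleftrightarrow>
     (\<forall>i<N. P i \<subseteq> V \<and> card (P i) \<le> q) \<and>
     (\<forall>i<N. \<forall>j<N. i \<noteq> j \<longrightarrow> P i \<inter> P j = {}) \<and>
     (\<forall>x<N. x \<in> B x \<and> B x \<subseteq> {..x} \<and> card (B x) \<le> w) \<and>
     (\<forall>x<N. 0 < x \<longrightarrow> par x < x \<and> B x - {x} \<subseteq> B (par x)) \<and>
     (\<forall>i<N. \<forall>j<N. i \<noteq> j \<longrightarrow> adj_sets E (P i) (P j) \<longrightarrow> (\<exists>x<N. i \<in> B x \<and> j \<in> B x))"

lemma rooted_partitionD:
  assumes "rooted_partition E V q w N P par B"
  shows "i < N \<Longrightarrow> P i \<subseteq> V" "i < N \<Longrightarrow> card (P i) \<le> q"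
    "i < N \<Longrightarrow> j < N \<Longrightarrow> i \<noteq> j \<Longrightarrow> P i \<inter> P j = {}"
    "x < N \<Longrightarrow> x \<in> B x" "x < N \<Longrightarrow> B x \<subseteq> {..x}" "x < N \<Longrightarrow> card (B x) \<le> w"
    "x < N \<Longrightarrow> 0 < x \<Longrightarrow> par x < x" "x < N \<Longrightarrow> 0 < x \<Longrightarrow> B x - {x} \<subseteq> B (par x)"
    "i < N \<Longrightarrow> j < N \<Longrightarrow> i \<noteq> j \<Longrightarrow> adj_sets E (P i) (P j) \<Longrightarrow> \<exists>x<N. i \<in> B x \<and> j \<in> B x"
  using assms by (simp_all add: rooted_partition_def)

text \<open>The new node \<open>N\<close> is hung below a node whose bag contains \<open>I\<close>.
  The strict bound on \<open>card I\<close> leaves room for \<open>N\<close> in its own bag.\<close>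

lemma rooted_partition_insert:
  assumes E: "sym E" and RP: "rooted_partition E V q w N P par B"
    and Q: "Q \<subseteq> V" "card Q \<le> q" "\<And>i. i < N \<Longrightarrow> Q \<inter> P i = {}"
    and I: "I \<subseteq> {..<N}" "card I < w" "0 < N \<Longrightarrow> p < N" "I \<noteq> {} \<Longrightarrow> I \<subseteq> B p"
    and adj: "\<And>i. i < N \<Longrightarrow> adj_sets E (P i) Q \<Longrightarrow> i \<in> I"
  shows "rooted_partition E V q w (Suc N) (P(N := Q)) (par(N := p)) (B(N := insert N I))"
proof -
  note RP = rooted_partitionD[OF RP]
  show ?thesis
    unfolding rooted_partition_def
  proof (intro conjI allI impI)
    fix i assume "i < Suc N"
    then show "(P(N := Q)) i \<subseteq> V" "card ((P(N := Q)) i) \<le> q"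
      using RP(1,2)[of i] Q by (auto simp: less_Suc_eq)
  next
    fix i j assume "i < Suc N" "j < Suc N" "i \<noteq> j"
    then show "(P(N := Q)) i \<inter> (P(N := Q)) j = {}"
      using RP(3)[of i j] Q(3)[of i] Q(3)[of j] by (auto simp: less_Suc_eq)
  next
    fix x assume x: "x < Suc N"
    show "x \<in> (B(N := insert N I)) x" "(B(N := insert N I)) x \<subseteq> {..x}"
      using x RP(4,5)[of x] I(1) by (auto simp: less_Suc_eq)
    have "card (insert N I) \<le> w" using I(2) card_insert_le_m1[of w I N] by linarith
    then show "card ((B(N := insert N I)) x) \<le> w"
      using x RP(6)[of x] by (auto simp: less_Suc_eq)
  next
    fix x assume x: "x < Suc N" "0 < x"
    show "(par(N := p)) x < x" using x RP(7)[of x] I(3) by (auto simp: less_Suc_eq)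
    show "(B(N := insert N I)) x - {x} \<subseteq> (B(N := insert N I)) ((par(N := p)) x)"
    proof (cases "x = N")
      case True
      then show ?thesis using x I(3,4) by auto
    next
      case False
      then have "x < N" using x by simp
      then show ?thesis using RP(7,8)[of x] x by auto
    qed
  next
    fix i j assume ij: "i < Suc N" "j < Suc N" "i \<noteq> j"
      and a: "adj_sets E ((P(N := Q)) i) ((P(N := Q)) j)"
    consider "i < N" "j < N" | "i = N" "j < N" | "i < N" "j = N" using ij by linarith
    then show "\<exists>x<Suc N. i \<in> (B(N := insert N I)) x \<and> j \<in> (B(N := insert N I)) x"
    proof cases
      case 1
      then obtain x where "x < N" "i \<in> B x \<and> j \<in> B x" using RP(9)[of i j] a ij by auto
      then show ?thesis by (intro exI[of _ x]) auto
    next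
      case 2
      then have "j \<in> I" using adj[of j] a E by (auto simp: adj_sets_commute)
      then show ?thesis using 2 by (intro exI[of _ N]) auto
    next
      case 3
      then have "i \<in> I" using adj[of i] a by auto
      then show ?thesis using 3 by (intro exI[of _ N]) auto
    qed
  qed
qed

text \<open>If \<open>D\<close> meets \<open>C\<close>, it is absorbed by \<open>C\<close>;
  otherwise it has no neighbour in \<open>Q\<close>, so it was a component before.\<close>

lemma component_after_removal:
  assumes E: "sym E" and C: "is_component E R C" and Q: "Q \<subseteq> C" and D: "is_component E (R - Q) D"
  shows "is_component E (C - Q) D \<or> is_component E R D"
proof (cases "D \<inter> C = {}")
  case True
  have "\<not> adj_sets E D (R - D)"
    unfolding adj_sets_def
  proof clarify
    fix d r assume dr: "d \<in> D" "r \<in> R" "r \<notin> D" "(d, r) \<in> E"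
    have "d \<in> R - C" using dr D True unfolding is_component_def by blast
    then have "r \<notin> C" using C symD[OF E dr(4)] unfolding is_component_def adj_sets_def by blast
    then show False using dr D Q unfolding is_component_def adj_sets_def by blast
  qed
  then show ?thesis using D unfolding is_component_def by blast
next
  case False
  have "D \<subseteq> C"
    using component_absorbs_connected[OF C _ _ False] D unfolding is_component_def by blast
  then have "is_component E (C - Q) D"
    using C D unfolding is_component_def adj_sets_def by blast
  then show ?thesis ..
qed

text \<open>Induction on the number of vertices left over. The invariant gives each remaining
  component a boundary model whose indices lie in one bag, and this bag tells where to attach the
  next node.\<close>

lemma rooted_partition_extend_to_all:
  assumes E: "sym E" and fin: "finite V"
    and bound: "\<And>P C I U. finite I \<Longrightarrow> C \<subseteq> V \<Longrightarrow> cut_connected E C \<Longrightarrow> boundary_model E V P C I U \<Longrightarrow> card I < w"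
    and q: "V \<noteq> {} \<Longrightarrow> 1 \<le> q" and small: "(w - 2) * card V < Suc q * Suc q"
  shows "rooted_partition E V q w N P par B \<Longrightarrow>
    (\<And>C. is_component E (V - (\<Union>i<N. P i)) C \<Longrightarrow>
      \<exists>I U. boundary_model E V P C I U \<and> (I = {} \<or> (\<exists>p<N. I \<subseteq> B p))) \<Longrightarrow>
    \<exists>N P par B. rooted_partition E V q w N P par B \<and> (\<Union>i<N. P i) = V"
proof (induction "card (V - (\<Union>i<N. P i))" arbitrary: N P par B rule: less_induct)
  case less
  note RP = less.prems(1)
  define R where "R = V - (\<Union>i<N. P i)"
  have PV: "(\<Union>i<N. P i) \<subseteq> V" using rooted_partitionD(1)[OF RP] by blast
  show ?case
  proof (cases "R = {}")
    case True
    then show ?thesis using RP PV unfolding R_def by blast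
  next
    case False
    then obtain x where "x \<in> R" by blast
    then obtain C where C: "is_component E R C" "x \<in> C" using component_containing[OF E] by metis
    obtain I U where M: "boundary_model E V P C I U" and I: "I = {} \<or> (\<exists>p<N. I \<subseteq> B p)"
      using less.prems(2) C(1) unfolding R_def by blast
    \<comment> \<open>With an empty boundary any older node may be the parent; the root 0 is
      taken.\<close>
    define p where "p = (if I = {} then 0 else SOME p. p < N \<and> I \<subseteq> B p)"
    have p: "p < N \<and> I \<subseteq> B p" if "I \<noteq> {}"
      unfolding p_def using that I someI_ex[of "\<lambda>p. p < N \<and> I \<subseteq> B p"] by auto
    have p0: "p < N" if "0 < N" using p that by (cases "I = {}") (auto simp: p_def)
    have IN: "I \<subseteq> {..<N}"
    proof (cases "I = {}")
      case False
      then have "B p \<subseteq> {..p}" using p rooted_partitionD(5)[OF RP] by blast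
      then show ?thesis using p[OF False] by force
    qed auto
    have finI: "finite I" using IN finite_subset by blast
    have CR: "C \<subseteq> R" "cut_connected E C" using C unfolding is_component_def by auto
    then have CV: "C \<subseteq> V" unfolding R_def by blast
    have cI: "card I < w" using bound[OF finI CV CR(2) M] .
    have "(card I - 1) * card C \<le> (w - 2) * card V"
      using cI card_mono[OF fin CV] by (intro mult_mono) auto
    then have sm: "(card I - 1) * card C < Suc q * Suc q" using small by (rule le_less_trans)
    have q1: "1 \<le> q" using q CV C by blast
    have NI: "N \<notin> I" using IN by blast
    obtain Q where Q: "Q \<subseteq> C" "Q \<noteq> {}" "card Q \<le> q"
      and QD: "\<And>D. is_component E (C - Q) D \<Longrightarrow>
        \<exists>I' U'. I' \<subseteq> insert N I \<and> boundary_model E V (P(N := Q)) D I' U'"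
      using boundary_model_extend[OF E finite_subset[OF CV fin] CV CR(2) M finI NI q1 sm] by metis
    define P' where "P' = P(N := Q)"
    define B' where "B' = B(N := insert N I)"
    have un: "(\<Union>i<Suc N. P' i) = (\<Union>i<N. P i) \<union> Q"
      unfolding P'_def by (auto simp: less_Suc_eq)
    then have R': "V - (\<Union>i<Suc N. P' i) = R - Q" unfolding R_def by blast
    have RP': "rooted_partition E V q w (Suc N) P' (par(N := p)) B'"
      unfolding P'_def B'_def
    proof (rule rooted_partition_insert[OF E RP _ Q(3) _ IN cI p0])
      show "Q \<subseteq> V" using Q CV by blast
      show disj: "Q \<inter> P i = {}" if "i < N" for i using that Q CR unfolding R_def by blast
      show "I \<subseteq> B p" if "I \<noteq> {}" using p[OF that] by blast
      \<comment> \<open>An end of the edge outside \<open>C\<close> lies in some \<open>P j\<close>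
        with \<open>j \<in> I\<close>, and disjointness of the parts gives
        \<open>i = j\<close>.\<close>
      show "i \<in> I" if i: "i < N" "adj_sets E (P i) Q" for i
      proof -
        obtain v c where vc: "v \<in> P i" "c \<in> Q" "(v, c) \<in> E" using i(2) unfolding adj_sets_def by blast
        have "v \<notin> C" using vc i CR unfolding R_def by blast
        then obtain j where j: "j \<in> I" "v \<in> P j"
          using boundary_modelD(7)[OF M vc(3)] vc Q by blast
        then have "i = j"
          using vc i IN rooted_partitionD(3)[OF RP] by blast
        then show ?thesis using j by blast
      qed
    qed
    have "card (R - Q) < card R"
      using Q CR fin R_def by (intro psubset_card_mono) auto
    then have dec: "card (V - (\<Union>i<Suc N. P' i)) < card (V - (\<Union>i<N. P i))"
      unfolding R' R_def .
    show ?thesis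
    proof (rule less.hyps[OF dec RP'])
      fix D assume "is_component E (V - (\<Union>i<Suc N. P' i)) D"
      then have "is_component E (R - Q) D" unfolding R' .
      from component_after_removal[OF E C(1) Q(1) this]
      show "\<exists>I U. boundary_model E V P' D I U \<and> (I = {} \<or> (\<exists>p<Suc N. I \<subseteq> B' p))"
      proof
        assume "is_component E (C - Q) D"
        then obtain I' U' where "I' \<subseteq> insert N I" "boundary_model E V P' D I' U'"
          using QD unfolding P'_def by blast
        moreover have "B' N = insert N I" unfolding B'_def by simp
        ultimately show ?thesis using lessI[of N] by metis
      next
        assume "is_component E R D"
        then obtain J W where J: "boundary_model E V P D J W" "J = {} \<or> (\<exists>p<N. J \<subseteq> B p)"
          using less.prems(2) unfolding R_def by blast
        have JN: "j < N" if j: "j \<in> J" for j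
        proof -
          obtain p where "p < N" "J \<subseteq> B p" using J(2) j by blast
          moreover from this have "B p \<subseteq> {..p}" using rooted_partitionD(5)[OF RP] by blast
          ultimately show ?thesis using j by force
        qed
        \<comment> \<open>Components not affected by \<open>Q\<close> keep their model, since its
          indices are below \<open>N\<close>.\<close>
        have "boundary_model E V P' D J W"
          by (rule boundary_model_cong[OF J(1)]) (use JN P'_def in auto)
        moreover have "J = {} \<or> (\<exists>p<Suc N. J \<subseteq> B' p)"
          using J(2) unfolding B'_def by (metis fun_upd_other less_SucI less_irrefl)
        ultimately show ?thesis by blast
      qed
    qed
  qed
qed

lemma rooted_partition_exists:
  assumes "sym E" "finite V" "E \<subseteq> V \<times> V"
    and "\<And>P C I U. finite I \<Longrightarrow> C \<subseteq> V \<Longrightarrow> cut_connected E C \<Longrightarrow> boundary_model E V P C I U \<Longrightarrow> card I < w"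
    and "V \<noteq> {} \<Longrightarrow> 1 \<le> q" "(w - 2) * card V < Suc q * Suc q"
  obtains N P par B where "rooted_partition E V q w N P par B" "(\<Union>i<N. P i) = V"
proof -
  have "\<exists>N P par B. rooted_partition E V q w N P par B \<and> (\<Union>i<N. P i) = V"
  proof (rule rooted_partition_extend_to_all[OF assms(1,2,4,5,6), where N = 0])
    show "rooted_partition E V q w 0 (\<lambda>_. {}) id (\<lambda>_. {})" unfolding rooted_partition_def by simp
    fix C assume C: "is_component E (V - (\<Union>i<0::nat. {})) C"
    \<comment> \<open>Initially a component of the whole graph has no outside neighbours, so the
      empty model works.\<close>
    have "v \<in> C" if "(v, c) \<in> E" "c \<in> C" for v c
      using C that symD[OF assms(1) that(1)] assms(3) unfolding is_component_def adj_sets_def by auto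
    then have "boundary_model E V (\<lambda>_. {}) C {} (\<lambda>_. {})" unfolding boundary_model_def by blast
    then show "\<exists>I U. boundary_model E V (\<lambda>_. {}) C I U \<and> (I = {} \<or> (\<exists>p<0::nat. I \<subseteq> {}))" by blast
  qed
  then show thesis using that by blast
qed

section \<open>Trees, treewidth and products\<close>

lemma connected_induce_if_cut_connected:
  assumes "cut_connected (parcs G) S"
  shows "Digraph_Component.connected (with_proj G \<restriction> S)"
proof -
  define A where "A = arcs_ends (with_proj G \<restriction> S)"
  have arcs: "(u, v) \<in> A" if "(u, v) \<in> parcs G" "u \<in> S" "v \<in> S" for u v
    using that unfolding A_def by (auto simp: arcs_ends_conv induce_subgraph_def image_iff)
  have "(u, v) \<in> rtrancl_on S (A\<^sup>s)" if "u \<in> S" "v \<in> S" for u v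
  proof (rule cut_connected_closed_subset[OF assms that(1), where Q = "\<lambda>v. (u, v) \<in> rtrancl_on S (A\<^sup>s)", OF _ _ that(2)])
    show "(u, u) \<in> rtrancl_on S (A\<^sup>s)" using that(1) by simp
    show "(u, y) \<in> rtrancl_on S (A\<^sup>s)"
      if "x \<in> S" "y \<in> S" "(u, x) \<in> rtrancl_on S (A\<^sup>s)" "(x, y) \<in> parcs G" for x y
      using that arcs[of x y] by (auto intro!: rtrancl_on_into_rtrancl_on[of u x] simp: symcl_def)
  qed
  then show ?thesis
    using assms unfolding connected_conv A_def by (auto simp: cut_connected_def)
qed

text \<open>Any \<open>w\<close> of the branch sets together with \<open>C\<close>, placed at index
  \<open>w\<close>, would model the complete graph on \<open>w + 1\<close> vertices.\<close>

lemma boundary_model_card_less: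
  assumes G: "pair_graph G" and free: "minor_free (complete_graph (Suc w)) G"
    and C: "C \<subseteq> pverts G" "cut_connected (parcs G) C"
    and M: "boundary_model (parcs G) (pverts G) P C I U"
  shows "card I < w"
proof (rule ccontr)
  assume "\<not> card I < w"
  then obtain J where J: "J \<subseteq> I" "card J = w" "finite J"
    by (metis linorder_not_less obtain_subset_with_card_n)
  obtain e where e: "bij_betw e {..<w} J"
    using ex_bij_betw_nat_finite[OF J(3)] J(2) atLeast0LessThan by auto
  have E: "sym (parcs G)"
    using pair_sym_digraph.pair_sym_arcs[of G] G unfolding pair_graph_def pair_pseudo_graph_def
    by (simp add: symmetric_def)
  note M = boundary_modelD[OF M]
  have eI: "e x \<in> I" if "x < w" for x using e J(1) that unfolding bij_betw_def by blast
  have e_inj: "e x \<noteq> e y" if "x < w" "y < w" "x \<noteq> y" for x y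
    using e that unfolding bij_betw_def inj_on_def by auto
  define \<mu> where "\<mu> x = (if x < w then U (e x) else C)" for x
  have "minor_model (complete_graph (Suc w)) G \<mu>"
    unfolding minor_model_def
  proof (intro conjI ballI impI)
    fix x assume "x \<in> pverts (complete_graph (Suc w))"
    show "\<mu> x \<subseteq> pverts G" using M(1) eI C unfolding \<mu>_def by auto
    show "Digraph_Component.connected (with_proj G \<restriction> \<mu> x)"
      by (rule connected_induce_if_cut_connected) (use M(2) eI C in \<open>auto simp: \<mu>_def\<close>)
  next
    fix x y assume "x \<in> pverts (complete_graph (Suc w))" "y \<in> pverts (complete_graph (Suc w))" "x \<noteq> y"
    then have xy: "x \<le> w" "y \<le> w" "x \<noteq> y" by (auto simp: complete_graph_def)
    show "\<mu> x \<inter> \<mu> y = {}"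
      using xy M(3)[OF eI, of x] M(3)[OF eI, of y] M(5)[OF eI eI e_inj, of x y]
      unfolding \<mu>_def by auto
  next
    fix a assume "a \<in> parcs (complete_graph (Suc w))"
    then obtain x y where a: "a = (x, y)" "x \<le> w" "y \<le> w" "x \<noteq> y" by (auto simp: complete_graph_def)
    have "adj_sets (parcs G) (\<mu> x) (\<mu> y)"
      using a M(4)[OF eI, of x] M(4)[OF eI, of y] M(6)[OF eI eI e_inj, of x y]
        adj_sets_commute[OF E, of C]
      unfolding \<mu>_def by auto
    then show "case a of (x, y) \<Rightarrow> \<exists>u\<in>\<mu> x. \<exists>v\<in>\<mu> y. (u, v) \<in> parcs G"
      unfolding a adj_sets_def by simp
  qed
  then show False using free unfolding is_minor_def by blast
qed

section \<open>Trees given by parent functions\<close>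

definition parent_tree :: "nat \<Rightarrow> (nat \<Rightarrow> nat) \<Rightarrow> nat pair_pre_digraph" where
  "parent_tree N par = \<lparr>pverts = {..N},
     parcs = {(x, y). x \<le> N \<and> y \<le> N \<and> (0 < x \<and> y = par x \<or> 0 < y \<and> x = par y)}\<rparr>"

lemma pair_graph_parent_tree:
  assumes "\<And>x. 0 < x \<Longrightarrow> x \<le> N \<Longrightarrow> par x < x"
  shows "pair_graph (parent_tree N par)"
proof -
  have "finite (parcs (parent_tree N par))"
    by (rule finite_subset[of _ "{..N} \<times> {..N}"]) (auto simp: parent_tree_def)
  moreover have "symmetric (with_proj (parent_tree N par))"
    by (auto simp: symmetric_def parent_tree_def intro!: symI)
  moreover have "fst e \<noteq> snd e" if "e \<in> parcs (parent_tree N par)" for e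
    using that assms[of "fst e"] assms[of "snd e"] by (auto simp: parent_tree_def)
  moreover have "finite (pverts (parent_tree N par))"
    "parcs (parent_tree N par) \<subseteq> pverts (parent_tree N par) \<times> pverts (parent_tree N par)"
    by (auto simp: parent_tree_def)
  ultimately show ?thesis by unfold_locales auto
qed

lemma sym_parcs_parent_tree: "sym (parcs (parent_tree N par))"
  by (auto simp: parent_tree_def intro!: symI)

text \<open>Passing to parents leads from every node of \<open>S\<close> down to \<open>r\<close>
  within \<open>S\<close>. This serves both the whole tree and the nodes whose bags contain a given
  vertex.\<close>

lemma cut_connected_parent_tree:
  assumes par: "\<And>x. 0 < x \<Longrightarrow> x \<le> N \<Longrightarrow> par x < x"
    and S: "S \<subseteq> {..N}" "r \<in> S" "\<And>x. x \<in> S \<Longrightarrow> x \<noteq> r \<Longrightarrow> 0 < x \<and> par x \<in> S"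
  shows "cut_connected (parcs (parent_tree N par)) S"
proof (rule cut_connectedI[OF S(2) _ sym_parcs_parent_tree])
  fix A y
  assume A: "r \<in> A" "A \<subseteq> S"
    "\<And>u v. u \<in> A \<Longrightarrow> v \<in> S \<Longrightarrow> (u, v) \<in> parcs (parent_tree N par) \<Longrightarrow> v \<in> A" and y: "y \<in> S"
  from y show "y \<in> A"
  proof (induction y rule: less_induct)
    case (less y)
    show ?case
    proof (cases "y = r")
      case False
      then have y: "0 < y" "par y \<in> S" "y \<le> N" using S less.prems by auto
      then have "par y < y" "par y \<in> A" using par less.IH by auto
      moreover have "(par y, y) \<in> parcs (parent_tree N par)"
        using y S(1) by (auto simp: parent_tree_def)
      ultimately show ?thesis using A(3) less.prems by blast
    qed (use A in simp)
  qed
qed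

lemma pcas_consecutive:
  assumes "pcas u p v"
  shows "(\<forall>i. Suc i < length p \<longrightarrow> snd (p ! i) = fst (p ! Suc i)) \<and>
    (p \<noteq> [] \<longrightarrow> fst (p ! 0) = u \<and> snd (p ! (length p - 1)) = v)"
  using assms
proof (induction p arbitrary: u)
  case (Cons e p)
  then have IH: "(\<forall>i. Suc i < length p \<longrightarrow> snd (p ! i) = fst (p ! Suc i)) \<and>
    (p \<noteq> [] \<longrightarrow> fst (p ! 0) = snd e \<and> snd (p ! (length p - 1)) = v)" by auto
  show ?case
  proof (intro conjI allI impI)
    fix i assume "Suc i < length (e # p)"
    then show "snd ((e # p) ! i) = fst ((e # p) ! Suc i)" using IH by (cases i) auto
  next
    show "fst ((e # p) ! 0) = u" using Cons.prems by simp
    show "snd ((e # p) ! (length (e # p) - 1)) = v"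
      using IH Cons.prems by (cases p) auto
  qed
qed simp

lemma pawalk_verts_eq: "pcas u p v \<Longrightarrow> pawalk_verts u p = u # map snd p"
  by (induction p arbitrary: u) auto

text \<open>The largest vertex of a cycle would have two distinct smaller neighbours on the cycle.\<close>

lemma no_cycle_parent_tree:
  assumes par: "\<And>x. 0 < x \<Longrightarrow> x \<le> N \<Longrightarrow> par x < x"
    and cyc: "pre_digraph.cycle (with_proj (parent_tree N par)) p" and len: "3 \<le> length p"
  shows False
proof -
  define n where "n = length p"
  obtain u where u: "set p \<subseteq> parcs (parent_tree N par)" "pcas u p u" "distinct (map snd p)"
    using cyc unfolding pre_digraph.cycle_def pre_digraph.awalk_def
    by (auto simp: cas_with_proj_eq awalk_verts_with_proj_eq pawalk_verts_eq)
  note cons = pcas_consecutive[OF u(2)]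
  have "p \<noteq> []" using len by auto
  define M where "M = Max (snd ` set p)"
  have "M \<in> snd ` set p" unfolding M_def using \<open>p \<noteq> []\<close> by (intro Max_in) auto
  then obtain i where i: "i < n" "snd (p ! i) = M" unfolding n_def by (metis imageE in_set_conv_nth)
  have le: "snd (p ! j) \<le> M" if "j < n" for j
    unfolding M_def using that n_def by (intro Max_ge) auto
  \<comment> \<open>Cyclic successor and predecessor of position \<open>i\<close>; they differ
    because the length is at least 3.\<close>
  define j where "j = (if Suc i < n then Suc i else 0)"
  define k where "k = (if i = 0 then n - 1 else i - 1)"
  have jk: "j < n" "k < n" "j \<noteq> k" using i len unfolding j_def k_def n_def by auto
  have fj: "fst (p ! j) = M"
  proof (cases "Suc i < n")
    case True
    then show ?thesis using cons i unfolding j_def n_def by auto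
  next
    case False
    then have "i = n - 1" using i by simp
    then show ?thesis using cons i \<open>p \<noteq> []\<close> False unfolding j_def n_def by simp
  qed
  have fi: "fst (p ! i) = snd (p ! k)"
  proof (cases i)
    case 0
    then show ?thesis using cons \<open>p \<noteq> []\<close> unfolding k_def n_def by simp
  next
    case (Suc i')
    then show ?thesis using cons i unfolding k_def n_def by simp
  qed
  have arc: "p ! l \<in> parcs (parent_tree N par)" if "l < n" for l
    using u(1) that unfolding n_def by auto
  \<comment> \<open>An arc between \<open>M\<close> and a vertex not above \<open>M\<close> can only
    join \<open>M\<close> to its parent.\<close>
  have "snd (p ! j) = par M"
  proof -
    have "(M, snd (p ! j)) \<in> parcs (parent_tree N par)" using arc[OF jk(1)] fj by (metis prod.collapse)
    then show ?thesis using le[OF jk(1)] par[of "snd (p ! j)"] by (auto simp: parent_tree_def)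
  qed
  moreover have "snd (p ! k) = par M"
  proof -
    have "(snd (p ! k), M) \<in> parcs (parent_tree N par)" using arc[OF i(1)] fi i(2) by (metis prod.collapse)
    then show ?thesis using le[OF jk(2)] par[of "snd (p ! k)"] by (auto simp: parent_tree_def)
  qed
  ultimately have "map snd p ! j = map snd p ! k" using jk unfolding n_def by simp
  then show False using nth_eq_iff_index_eq[OF u(3), of j k] jk unfolding n_def by simp
qed

lemma undirected_tree_parent_tree:
  assumes par: "\<And>x. 0 < x \<Longrightarrow> x \<le> N \<Longrightarrow> par x < x"
  shows "undirected_tree (parent_tree N par)"
proof -
  let ?T = "parent_tree N par"
  have "cut_connected (parcs ?T) {..N}"
    by (rule cut_connected_parent_tree[OF par, where r = 0])
       (use par in \<open>auto simp: less_imp_le intro: order.trans[OF less_imp_le[OF par]]\<close>)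
  then have "Digraph_Component.connected (with_proj ?T \<restriction> {..N})"
    by (rule connected_induce_if_cut_connected)
  moreover have "with_proj ?T \<restriction> {..N} = with_proj ?T"
    by (auto simp: induce_subgraph_def with_proj_def parent_tree_def)
  ultimately have "Digraph_Component.connected (with_proj ?T)" by simp
  then show ?thesis
    unfolding undirected_tree_def
    using pair_graph_parent_tree[OF par] no_cycle_parent_tree[OF par] by blast
qed

section \<open>Treewidth bounds and subgraphs of products\<close>

lemma treewidth_le:
  assumes TD: "tree_decomposition H T B" and card: "\<And>x. x \<in> pverts T \<Longrightarrow> card (B x) \<le> w"
  shows "treewidth H \<le> int w - 1"
proof -
  have T: "finite (pverts T) \<and> pverts T \<noteq> {}" if "tree_decomposition H T B" for T B
  proof -
    have "undirected_tree T" using that unfolding tree_decomposition_def by blast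
    then show ?thesis
      unfolding undirected_tree_def connected_conv
      by (auto dest: pair_graph.axioms(1) pair_digraph.axioms(1) pair_fin_digraph.pair_finite_verts)
  qed
  \<comment> \<open>A lower bound on all widths makes the infimum at most each of them.\<close>
  have ge: "-1 \<le> decomposition_width T B" if TD': "tree_decomposition H T B" for T B
  proof -
    obtain x where "x \<in> pverts T" using T[OF TD'] by blast
    then have "int (card (B x)) \<le> Max ((\<lambda>x. int (card (B x))) ` pverts T)"
      using T[OF TD'] by (intro Max_ge) auto
    then show ?thesis unfolding decomposition_width_def by linarith
  qed
  have "treewidth H \<le> decomposition_width T B"
    unfolding treewidth_def
  proof (rule cInf_lower)
    show "bdd_below {decomposition_width T B |T B. tree_decomposition H T B}"
      using ge by (intro bdd_belowI[of _ "-1"]) auto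
  qed (use TD in blast)
  moreover have "Max ((\<lambda>x. int (card (B x))) ` pverts T) \<le> int w"
    using T[OF TD] card by (intro Max.boundedI) auto
  then have "decomposition_width T B \<le> int w - 1" unfolding decomposition_width_def by simp
  ultimately show ?thesis by linarith
qed

lemma isomorphic_to_subgraphI:
  assumes "pair_graph G" "pair_graph P" "inj_on \<phi> (pverts G)" "\<phi> ` pverts G \<subseteq> pverts P"
    and "\<And>u v. (u, v) \<in> parcs G \<Longrightarrow> (\<phi> u, \<phi> v) \<in> parcs P"
  shows "isomorphic_to_subgraph G P"
proof -
  interpret G: pair_graph G by fact
  interpret P: pair_graph P by fact
  \<comment> \<open>The subgraph is the image of \<open>G\<close>, its arcs being the pairs of
    images.\<close>
  define f where
    "f = \<lparr>iso_verts = \<phi>, iso_arcs = map_prod \<phi> \<phi>, iso_head = snd, iso_tail = fst\<rparr>"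
  have wf: "wf_digraph (with_proj G)" "wf_digraph (with_proj P)" by unfold_locales
  have "inj_on (map_prod \<phi> \<phi>) (parcs G)"
    using assms(3) G.in_arcsD1 G.in_arcsD2 by (auto simp: inj_on_def)
  then have iso: "pre_digraph.digraph_isomorphism (with_proj G) f"
    unfolding pre_digraph.digraph_isomorphism_def f_def using wf assms(3) by auto
  have "wf_digraph (app_iso f (with_proj G))"
    by unfold_locales (auto simp: app_iso_def f_def dest: G.in_arcsD1 G.in_arcsD2)
  then have "subgraph (app_iso f (with_proj G)) (with_proj P)"
    unfolding subgraph_def using wf assms(4,5)
    by (auto simp: app_iso_def f_def compatible_def with_proj_def)
  then show ?thesis unfolding isomorphic_to_subgraph_def digraph_iso_def using iso by blast
qed

text \<open>
  Node \<open>N\<close> carries an empty bag; it is there because a tree has a node even if \<open>N = 0\<close>.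
\<close>

lemma rooted_partition_product_structure:
  assumes G: "pair_graph G"
    and RP: "rooted_partition (parcs G) (pverts G) q w N P par B" and cover: "(\<Union>i<N. P i) = pverts G"
    and m: "q \<le> m"
  shows "\<exists>H :: nat pair_pre_digraph. pair_graph H \<and> treewidth H \<le> int w - 1 \<and>
    isomorphic_to_subgraph G (H \<boxtimes> complete_graph m)"
proof -
  note RP = rooted_partitionD[OF RP]
  interpret G: pair_graph G by fact
  \<comment> \<open>Vertices of \<open>H\<close> are the indices of parts, and every bag is made a
    clique; so all edges of \<open>H\<close> lie in bags, and adjacent parts are adjacent in
    \<open>H\<close>.\<close>
  define H where "H = \<lparr>pverts = {..<N},
    parcs = {(i, j). i < N \<and> j < N \<and> i \<noteq> j \<and> (\<exists>x<N. i \<in> B x \<and> j \<in> B x)}\<rparr>"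
  have H: "pair_graph H"
  proof -
    have "finite (parcs H)"
      by (rule finite_subset[of _ "{..<N} \<times> {..<N}"]) (auto simp: H_def)
    moreover have "symmetric (with_proj H)" by (auto simp: symmetric_def H_def intro!: symI)
    ultimately show ?thesis by unfold_locales (auto simp: H_def)
  qed
  define par' where "par' = par(N := 0)"
  define B' where "B' = B(N := {})"
  define T where "T = parent_tree N par'"
  have par': "par' x < x" if "0 < x" "x \<le> N" for x
    using that RP(7)[of x] unfolding par'_def by auto
  have "tree_decomposition H T B'"
    unfolding tree_decomposition_def
  proof (intro conjI ballI)
    show "undirected_tree T" unfolding T_def using undirected_tree_parent_tree[OF par'] .
  next
    fix x assume "x \<in> pverts T"
    then show "B' x \<subseteq> pverts H"
      using RP(5)[of x] by (cases "x = N") (auto simp: T_def parent_tree_def B'_def H_def)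
  next
    fix a assume "a \<in> parcs H"
    then obtain i j x where a: "a = (i, j)" "x < N" "i \<in> B x" "j \<in> B x" unfolding H_def by auto
    then show "case a of (u, v) \<Rightarrow> \<exists>x\<in>pverts T. u \<in> B' x \<and> v \<in> B' x"
      unfolding T_def parent_tree_def B'_def by (auto intro!: bexI[of _ x])
  next
    fix v assume "v \<in> pverts H"
    then have v: "v < N" unfolding H_def by simp
    define S where "S = {x \<in> pverts T. v \<in> B' x}"
    have S: "x \<in> S \<longleftrightarrow> x < N \<and> v \<in> B x" for x
      unfolding S_def T_def parent_tree_def B'_def by auto
    have "cut_connected (parcs T) S"
      unfolding T_def
    \<comment> \<open>Bags containing \<open>v\<close> start at the node \<open>v\<close> where its
      part was created; at later nodes \<open>v\<close> is inherited from the parent's bag.\<close>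
    proof (rule cut_connected_parent_tree[OF par', where r = v])
      fix x assume x: "x \<in> S" "x \<noteq> v"
      then have "v < x" using S RP(5)[of x] by force
      then show "0 < x \<and> par' x \<in> S"
        using x S RP(7,8)[of x] unfolding par'_def by auto
    qed (use v S RP(4) in auto)
    then show "Digraph_Component.connected (with_proj T \<restriction> {x \<in> pverts T. v \<in> B' x})"
      unfolding S_def by (rule connected_induce_if_cut_connected)
  qed
  then have tw: "treewidth H \<le> int w - 1"
    by (rule treewidth_le) (use RP(6) in \<open>auto simp: T_def parent_tree_def B'_def\<close>)
  have "\<exists>f. \<forall>v\<in>pverts G. f v < N \<and> v \<in> P (f v)"
    using cover by (intro bchoice) blast
  then obtain f where f: "\<And>v. v \<in> pverts G \<Longrightarrow> f v < N \<and> v \<in> P (f v)" by blast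
  have "\<exists>g. inj_on g (P i) \<and> g ` P i \<subseteq> {..<m}" if "i < N" for i
  proof -
    have "finite (P i)" using RP(1)[OF that] G.pair_finite_verts finite_subset by blast
    then show ?thesis
      using card_le_inj[of "P i" "{..<m}"] RP(2)[OF that] m by auto
  qed
  then obtain g where g: "\<And>i. i < N \<Longrightarrow> inj_on (g i) (P i) \<and> g i ` P i \<subseteq> {..<m}" by metis
  \<comment> \<open>First coordinate: the part; second: a numbering within the part. Adjacent
    vertices of one part differ in the second coordinate, and those of different parts have first
    coordinates adjacent in \<open>H\<close>.\<close>
  define \<phi> where "\<phi> v = (f v, g (f v) v)" for v
  have inj: "inj_on \<phi> (pverts G)"
  proof (rule inj_onI)
    fix u v assume uv: "u \<in> pverts G" "v \<in> pverts G" "\<phi> u = \<phi> v"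
    then have "f u = f v" "g (f u) u = g (f u) v" unfolding \<phi>_def by auto
    then show "u = v" using g[of "f u"] f[OF uv(1)] f[OF uv(2)] by (auto dest: inj_onD)
  qed
  have range: "f v < N" "g (f v) v < m" if "v \<in> pverts G" for v
    using f[OF that] g[of "f v"] by auto
  have K: "pair_graph (complete_graph m)"
  proof -
    have "finite (parcs (complete_graph m))"
      by (rule finite_subset[of _ "{..<m} \<times> {..<m}"]) (auto simp: complete_graph_def)
    then show ?thesis
      by unfold_locales (auto simp: complete_graph_def symmetric_def intro!: symI)
  qed
  have "isomorphic_to_subgraph G (H \<boxtimes> complete_graph m)"
  proof (rule isomorphic_to_subgraphI[OF G pair_graph_strong_product[OF H K] inj])
    show "\<phi> ` pverts G \<subseteq> pverts (H \<boxtimes> complete_graph m)"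
      using range unfolding \<phi>_def by (auto simp: strong_product_def H_def complete_graph_def)
    fix u v assume e: "(u, v) \<in> parcs G"
    have uv: "u \<in> pverts G" "v \<in> pverts G" "u \<noteq> v"
      using G.in_arcsD1[OF e] G.in_arcsD2[OF e] G.no_loops'[OF e] by auto
    have "\<phi> u \<noteq> \<phi> v" using inj uv unfolding inj_on_def by blast
    moreover have "(f u, f v) \<in> parcs H" if "f u \<noteq> f v"
    proof -
      have "adj_sets (parcs G) (P (f u)) (P (f v))" using e f uv unfolding adj_sets_def by blast
      then show ?thesis using RP(9)[of "f u" "f v"] f uv that unfolding H_def by auto
    qed
    ultimately show "(\<phi> u, \<phi> v) \<in> parcs (H \<boxtimes> complete_graph m)"
      using range[OF uv(1)] range[OF uv(2)]
      unfolding \<phi>_def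
      by (cases "f u = f v") (auto simp: strong_product_def complete_graph_def H_def)
  qed
  then show ?thesis using H tw by blast
qed

section \<open>Choice of the parameters\<close>

theorem theorem2:
  fixes G :: "'a pair_pre_digraph" and t n :: nat
  assumes "t \<ge> 4"
    and "pair_graph G"
    and "card (pverts G) = n"
    and "minor_free (complete_graph t) G"
  shows "(\<exists>H :: nat pair_pre_digraph.
            pair_graph H \<and> treewidth H \<le> int t - 1 \<and>
            isomorphic_to_subgraph G
              (H \<boxtimes> complete_graph (nat \<lfloor>sqrt ((real t - 3) * real n)\<rfloor>))) \<and>
         (\<exists>H :: nat pair_pre_digraph.
            pair_graph H \<and> treewidth H \<le> int t - 2 \<and>
            isomorphic_to_subgraph G
              (H \<boxtimes> complete_graph (nat \<lfloor>2 * sqrt ((real t - 3) * real n)\<rfloor>)))"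
proof -
  interpret G: pair_graph G by fact
  define s where "s = sqrt ((real t - 3) * real n)"
  define q where "q = nat \<lfloor>s\<rfloor>"
  define w where "w = t - 1"
  have w: "Suc w = t" "w - 2 = t - 3" using assms(1) unfolding w_def by auto
  have s0: "0 \<le> s" unfolding s_def using assms(1) by simp
  have sq: "s * s = real ((t - 3) * n)"
    unfolding s_def using assms(1) by (simp add: of_nat_diff)
  \<comment> \<open>Rounding down costs less than one, and squaring gives exactly the strict
    inequality of the separator lemma.\<close>
  have "s < real (Suc q)" using s0 unfolding q_def by linarith
  then have "s * s < real (Suc q) * real (Suc q)" using s0 by (intro mult_strict_mono) auto
  then have "real ((t - 3) * n) < real (Suc q * Suc q)" unfolding sq by (simp only: of_nat_mult)
  then have small: "(w - 2) * card (pverts G) < Suc q * Suc q"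
    unfolding w(2) assms(3) of_nat_less_iff .
  have q1: "1 \<le> q" if "pverts G \<noteq> {}"
  proof -
    have "1 \<le> n" using that assms(3) G.pair_finite_verts by (metis One_nat_def Suc_leI card_gt_0_iff)
    then have "1 \<le> (real t - 3) * real n" using assms(1) mult_mono[of 1 "real t - 3" 1 "real n"] by simp
    then have "1 \<le> s" unfolding s_def by simp
    then show ?thesis unfolding q_def by linarith
  qed
  have E: "sym (parcs G)" using G.pair_sym_arcs by (simp add: symmetric_def)
  have EV: "parcs G \<subseteq> pverts G \<times> pverts G" using G.in_arcsD1 G.in_arcsD2 by auto
  obtain N P par B where RP: "rooted_partition (parcs G) (pverts G) q w N P par B"
    "(\<Union>i<N. P i) = pverts G"
  proof (rule rooted_partition_exists[OF E G.pair_finite_verts EV _ _ small])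
    show "card I < w"
      if "finite I" "C \<subseteq> pverts G" "cut_connected (parcs G) C"
        "boundary_model (parcs G) (pverts G) P C I U" for P C I U
      using boundary_model_card_less[OF assms(2) _ that(2-4)] assms(4) w(1) by simp
  qed (use q1 in auto)
  note ps = rooted_partition_product_structure[OF assms(2) RP]
  \<comment> \<open>Parts of order at most \<open>q\<close> can also be numbered within the larger
    complete graph, which gives (b).\<close>
  have "q \<le> nat \<lfloor>2 * s\<rfloor>" unfolding q_def using s0 by (intro nat_mono floor_mono) simp
  moreover have "int w - 1 = int t - 2" using w(1) by simp
  ultimately obtain H\<^sub>a H\<^sub>b :: "nat pair_pre_digraph"
    where "pair_graph H\<^sub>a" "treewidth H\<^sub>a \<le> int t - 2"
      "isomorphic_to_subgraph G (H\<^sub>a \<boxtimes> complete_graph q)"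
      "pair_graph H\<^sub>b" "treewidth H\<^sub>b \<le> int t - 2"
      "isomorphic_to_subgraph G (H\<^sub>b \<boxtimes> complete_graph (nat \<lfloor>2 * s\<rfloor>))"
    using ps[OF order_refl] ps[of "nat \<lfloor>2 * s\<rfloor>"] by metis
  then show ?thesis
    unfolding q_def s_def by (intro conjI exI[of _ H\<^sub>a] exI[of _ H\<^sub>b]) auto
qed

end
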